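(* Suppose that for every $i\in[m]$ the function $f_i$ is gradient Lipschitz continuous with constant $r_i>0$, and let $\{(\mathbf{y}^k,X^k,\Pi^k)\}$ be a sequence generated by the CEADMM algorithm with $\sigma_i>2w_ir_i$ for every $i\in[m]$. Suppose that the level set $\mathcal{S}(\mathcal{L}^0)$ is bounded and that $f$ is convex. Then: (i) The sequences $\{\mathcal{L}^k\}$, $\{F(X^k)\}$ and $\{f(\mathbf{y}^k)\}$ converge to the optimal function value of problem (P): $$\lim_{k\to\infty}\mathcal{L}^k=\lim_{k\to\infty}F(X^k)=\lim_{k\to\infty}f(\mathbf{y}^k)=f^*.$$ (ii) Any accumulation point $(\mathbf{y}^\infty,X^\infty,\Pi^\infty)$ of $\{(\mathbf{y}^k,X^k,\Pi^k)\}$ is an optimal solution to (P'), and $\mathbf{y}^\infty$ is an optimal solution to (P). (iii) If, in addition, $f$ is strongly convex, then the whole sequence $\{(\mathbf{y}^k,X^k,\Pi^k)\}$ converges to the unique optimal solution $(\mathbf{x}^*,X^*,\Pi^* )$ to (P'), where $\mathbf{x}^*$ is the unique optimal solution to (P).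
   Context: Setting. $m,n\ge 1$ are integers, $[m]=\{1,\dots,m\}$, $w_1,\dots,w_m>0$ with $\sum_i w_i=1$, and each $f_i:\mathbb{R}^n\to\mathbb{R}$ is bounded from below. $f(\mathbf{x}):=\sum_{i=1}^m w_if_i(\mathbf{x})$. Problem (P): $\min_{\mathbf{x}\in\mathbb{R}^n} f(\mathbf{x})$, with minimizer $\mathbf{x}^*$ and optimal value $f^*:=f(\mathbf{x}^* )>-\infty$. Problem (P'): $\min_{\mathbf{x},\mathbf{x}_1,\dots,\mathbf{x}_m\in\mathbb{R}^n}\sum_{i=1}^m w_if_i(\mathbf{x}_i)$ subject to $\mathbf{x}_i=\mathbf{x}$, $i\in[m]$. A function $g$ is gradient Lipschitz continuous with constant $r$ if it is differentiable and $\|\nabla g(\mathbf{x})-\nabla g(\mathbf{z})\|\le r\|\mathbf{x}-\mathbf{z}\|$ for all $\mathbf{x},\mathbf{z}$ (Euclidean norm). A triple $(\mathbf{x},X,\Pi)$, $X=(\mathbf{x}_1,\dots,\mathbf{x}_m)$, $\Pi=(\boldsymbol{\pi}_1,\dots,\boldsymbol{\pi}_m)$, is called an optimal solution to (P') if $(\mathbf{x},X)$ solves (P') and $\Pi$ is a corresponding Lagrange multiplier, i.e. $w_i\nabla f_i(\mathbf{x}_i)+\boldsymbol{\pi}_i=0$ and $\mathbf{x}_i=\mathbf{x}$ for all $i\in[m]$, and $\sum_{i=1}^m\boldsymbol{\pi}_i=0$. CEADMM algorithm. Parameters $\sigma_i>0$ ($i\in[m]$), $\sigma:=\sum_i\sigma_i$,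 an integer $k_0>0$, initial points $\mathbf{x}_i^0,\boldsymbol{\pi}_i^0\in\mathbb{R}^n$ ($i\in[m]$) and $\mathbf{y}^0\in\mathbb{R}^n$. Put $\mathcal{K}=\{0,k_0,2k_0,\dots\}$ and $\tau_k=\lfloor k/k_0\rfloor k_0$. For $k=0,1,2,\dots$: if $k\in\mathcal{K}$, set $\mathbf{x}^{k+1}=\sum_{i=1}^m\frac{\sigma_i}{\sigma}\mathbf{x}_i^k+\frac1\sigma\sum_{i=1}^m\boldsymbol{\pi}_i^k$. Then, with $\mathbf{y}^{k+1}:=\mathbf{x}^{\tau_k+1}$, for each $i\in[m]$ let $\mathbf{x}_i^{k+1}$ be a minimizer over $\mathbf{x}_i\in\mathbb{R}^n$ of $w_if_i(\mathbf{x}_i)+\langle\mathbf{x}_i-\mathbf{y}^{k+1},\boldsymbol{\pi}_i^k\rangle+\frac{\sigma_i}{2}\|\mathbf{x}_i-\mathbf{y}^{k+1}\|^2$, and set $\boldsymbol{\pi}_i^{k+1}=\boldsymbol{\pi}_i^k+\sigma_i(\mathbf{x}_i^{k+1}-\mathbf{y}^{k+1})$. Write $X^k=(\mathbf{x}_1^k,\dots,\mathbf{x}_m^k)$, $\Pi^k=(\boldsymbol{\pi}_1^k,\dots,\boldsymbol{\pi}_m^k)$. Notation. $\mathcal{L}^k:=\mathcal{L}(\mathbf{y}^k,X^k,\Pi^k)$, where $\mathcal{L}(\mathbf{x},X,\Pi):=\sum_{i=1}^m\big(w_if_i(\mathbf{x}_i)+\langle\mathbf{x}_i-\mathbf{x},\boldsymbol{\pi}_i\rangle+\frac{\sigma_i}{2}\|\mathbf{x}_i-\mathbf{x}\|^2\big)$.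 $F(X):=\sum_{i=1}^m w_if_i(\mathbf{x}_i)$. $\mathcal{S}(\alpha):=\{\mathbf{x}\in\mathbb{R}^n: f(\mathbf{x})\le\alpha\}$. *)

theory Defs
  imports "HOL-Analysis.Analysis"
begin

(* The finite index type 'm plays the role of [m], and X :: real^'n^'m is the
   tuple (x_1, ..., x_m) with x_i = X $ i. *)

definition grad :: "('a::real_inner \<Rightarrow> real) \<Rightarrow> 'a \<Rightarrow> 'a" where
  "grad g x = (THE D. GDERIV g x :> D)"

definition gradient_lipschitz :: "real \<Rightarrow> ('a::euclidean_space \<Rightarrow> real) \<Rightarrow> bool" where
  "gradient_lipschitz r g \<longleftrightarrow>
     (\<forall>x. g differentiable (at x)) \<and>
     (\<forall>x z. norm (grad g x - grad g z) \<le> r * norm (x - z))"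

definition strongly_convex :: "('a::real_normed_vector \<Rightarrow> real) \<Rightarrow> bool" where
  "strongly_convex g \<longleftrightarrow>
     (\<exists>\<mu>>0. \<forall>x z. \<forall>t\<in>{0..1}.
        g ((1 - t) *\<^sub>R x + t *\<^sub>R z)
          \<le> (1 - t) * g x + t * g z - \<mu> / 2 * t * (1 - t) * (norm (x - z))\<^sup>2)"

definition minimizer :: "('a \<Rightarrow> real) \<Rightarrow> 'a \<Rightarrow> bool" where
  "minimizer g x \<longleftrightarrow> is_arg_min g (\<lambda>_. True) x"

definition accumulation_point :: "(nat \<Rightarrow> 'a::topological_space) \<Rightarrow> 'a \<Rightarrow> bool" where
  "accumulation_point s l \<longleftrightarrow> (\<exists>\<phi>. strict_mono \<phi> \<and> (s \<circ> \<phi>) \<longlonglongrightarrow> l)"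

definition objective ::
  "('m::finite \<Rightarrow> real) \<Rightarrow> ('m \<Rightarrow> real^'n \<Rightarrow> real) \<Rightarrow> real^'n \<Rightarrow> real" where
  "objective w f x = (\<Sum>i\<in>UNIV. w i * f i x)"

definition split_objective ::
  "('m::finite \<Rightarrow> real) \<Rightarrow> ('m \<Rightarrow> real^'n \<Rightarrow> real) \<Rightarrow> real^'n^'m \<Rightarrow> real" where
  "split_objective w f X = (\<Sum>i\<in>UNIV. w i * f i (X $ i))"

definition solves_consensus ::
  "('m::finite \<Rightarrow> real) \<Rightarrow> ('m \<Rightarrow> real^'n \<Rightarrow> real) \<Rightarrow> real^'n \<Rightarrow> real^'n^'m \<Rightarrow> bool" where
  "solves_consensus w f x X \<longleftrightarrow>
     is_arg_min (\<lambda>(x, X). split_objective w f X) (\<lambda>(x, X). \<forall>i. X $ i = x) (x, X)"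

definition consensus_optimal ::
  "('m::finite \<Rightarrow> real) \<Rightarrow> ('m \<Rightarrow> real^'n \<Rightarrow> real)
     \<Rightarrow> (real^'n) \<times> (real^'n^'m) \<times> (real^'n^'m) \<Rightarrow> bool" where
  "consensus_optimal w f = (\<lambda>(x, X, P).
     solves_consensus w f x X \<and>
     (\<forall>i. w i *\<^sub>R grad (f i) (X $ i) + P $ i = 0 \<and> X $ i = x) \<and>
     (\<Sum>i\<in>UNIV. P $ i) = 0)"

definition local_lagrangian ::
  "('m \<Rightarrow> real) \<Rightarrow> ('m \<Rightarrow> real^'n \<Rightarrow> real) \<Rightarrow> ('m \<Rightarrow> real)
     \<Rightarrow> 'm \<Rightarrow> real^'n \<Rightarrow> real^'n \<Rightarrow> real^'n \<Rightarrow> real" where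
  "local_lagrangian w f \<sigma> i x z p =
     w i * f i z + (z - x) \<bullet> p + \<sigma> i / 2 * (norm (z - x))\<^sup>2"

definition aug_lagrangian ::
  "('m::finite \<Rightarrow> real) \<Rightarrow> ('m \<Rightarrow> real^'n \<Rightarrow> real) \<Rightarrow> ('m \<Rightarrow> real)
     \<Rightarrow> real^'n \<Rightarrow> real^'n^'m \<Rightarrow> real^'n^'m \<Rightarrow> real" where
  "aug_lagrangian w f \<sigma> x X P =
     (\<Sum>i\<in>UNIV. local_lagrangian w f \<sigma> i x (X $ i) (P $ i))"

(* The initial values y 0, X 0, P 0 are arbitrary. The aggregate x is only
   constrained at indices k + 1 with k0 dvd k, i.e. at communication rounds;
   these are the only entries the algorithm reads. *)
definition ceadmm_sequence ::
  "('m::finite \<Rightarrow> real) \<Rightarrow> ('m \<Rightarrow> real^'n \<Rightarrow> real) \<Rightarrow> ('m \<Rightarrow> real) \<Rightarrow> nat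
     \<Rightarrow> (nat \<Rightarrow> real^'n) \<Rightarrow> (nat \<Rightarrow> real^'n^'m) \<Rightarrow> (nat \<Rightarrow> real^'n^'m) \<Rightarrow> bool" where
  "ceadmm_sequence w f \<sigma> k0 y X P \<longleftrightarrow>
     (\<exists>x :: nat \<Rightarrow> real^'n. \<forall>k.
        (k0 dvd k \<longrightarrow>
           x (k + 1) = (\<Sum>i\<in>UNIV. (\<sigma> i / (\<Sum>j\<in>UNIV. \<sigma> j)) *\<^sub>R X k $ i)
                     + (1 / (\<Sum>j\<in>UNIV. \<sigma> j)) *\<^sub>R (\<Sum>i\<in>UNIV. P k $ i)) \<and>
        y (k + 1) = x ((k div k0) * k0 + 1) \<and>
        (\<forall>i. minimizer (\<lambda>z. local_lagrangian w f \<sigma> i (y (k + 1)) z (P k $ i)) (X (k + 1) $ i) \<and>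
             P (k + 1) $ i = P k $ i + \<sigma> i *\<^sub>R (X (k + 1) $ i - y (k + 1))))"

end

theory Submission
  imports Defs
begin

text \<open>From the first iterate on, every multiplier equals minus the weighted local gradient. The
  augmented Lagrangian then decreases by a positive multiple of the squared step lengths and
  dominates the objective at \<open>y k\<close>, so the steps, the consensus gaps and the gradients of the
  objective at the communication rounds are square summable. Hence the distance of \<open>y\<close> to a
  minimizer grows at most like the square root of the number of rounds, and by convexity the excess
  of the objective is at most that distance times the norm of the gradient; a positive limit of
  the excess would make the harmonic series converge.\<close>

subsection \<open>Gradients\<close>

text \<open>As \<open>grad\<close> is a definite description, both existence and uniqueness are
  needed: a linear functional on a Euclidean space is represented by its values on the basis, and
  two representing vectors agree when tested on their difference.\<close>

lemma gderiv_grad: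
  fixes g :: "'a::euclidean_space \<Rightarrow> real"
  assumes "g differentiable (at x)"
  shows "GDERIV g x :> grad g x"
proof -
  obtain g' where g': "(g has_derivative g') (at x)"
    using assms by (auto simp: differentiable_def)
  interpret linear g'
    using g' by (rule has_derivative_linear)
  define D where "D = (\<Sum>b\<in>Basis. g' b *\<^sub>R b)"
  have "g' h = inner h D" for h
  proof -
    have "g' h = g' (\<Sum>b\<in>Basis. (h \<bullet> b) *\<^sub>R b)"
      by (simp add: euclidean_representation)
    also have "\<dots> = (\<Sum>b\<in>Basis. (h \<bullet> b) * g' b)"
      by (simp add: sum scale)
    finally show ?thesis
      by (simp add: D_def inner_sum_right mult.commute)
  qed
  then have "g' = (\<lambda>h. inner h D)" ..
  with g' have D: "GDERIV g x :> D"
    by (simp add: gderiv_def)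
  have "D' = D" if "GDERIV g x :> D'" for D'
  proof -
    have "(\<lambda>h. h \<bullet> D') = (\<lambda>h. h \<bullet> D)"
      using has_derivative_unique[OF that[unfolded gderiv_def] D[unfolded gderiv_def]] .
    then have "(D' - D) \<bullet> (D' - D) = 0"
      by (simp add: inner_diff_right fun_eq_iff)
    then show ?thesis
      by simp
  qed
  with D have "grad g x = D"
    unfolding grad_def by (rule the_equality)
  with D show ?thesis
    by simp
qed

lemma GDERIV_sum:
  assumes "\<And>i. i \<in> A \<Longrightarrow> GDERIV (g i) x :> D i"
  shows "GDERIV (\<lambda>x. \<Sum>i\<in>A. g i x) x :> (\<Sum>i\<in>A. D i)"
  using assms unfolding gderiv_def inner_sum_right by (rule has_derivative_sum)

lemma GDERIV_cmult:
  assumes "GDERIV g x :> D"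
  shows "GDERIV (\<lambda>x. c * g x) x :> c *\<^sub>R D"
  using assms unfolding gderiv_def inner_scaleR_right by (rule has_derivative_mult_right)

lemma GDERIV_compose_line:
  fixes g :: "'a::real_inner \<Rightarrow> real"
  assumes "GDERIV g (x + t *\<^sub>R d) :> D"
  shows "((\<lambda>t. g (x + t *\<^sub>R d)) has_real_derivative d \<bullet> D) (at t)"
proof -
  have "((\<lambda>t. x + t *\<^sub>R d) has_derivative (\<lambda>h. h *\<^sub>R d)) (at t)"
    by (auto intro!: derivative_eq_intros)
  from has_derivative_compose[OF this assms[unfolded gderiv_def]] show ?thesis
    by (simp add: has_field_derivative_def mult.commute[of _ "d \<bullet> D"])
qed

lemma GDERIV_minimizer_eq_0:
  assumes "GDERIV g x :> D" "minimizer g x"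
  shows "D = 0"
proof -
  have "(\<lambda>h. h \<bullet> D) = (\<lambda>h. 0)"
    using assms(1)[unfolded gderiv_def]
  proof (rule has_derivative_local_min)
    show "eventually (\<lambda>y. g x \<le> g y) (at x)"
      using assms(2) by (intro always_eventually) (auto simp: minimizer_def is_arg_min_linorder)
  qed
  then show ?thesis
    by (metis inner_eq_zero_iff)
qed

text \<open>Restricting \<open>g\<close> to the line through \<open>x\<close> and \<open>z\<close>
  reduces the claim to the tangent inequality for convex functions of one real variable.\<close>

lemma convex_on_GDERIV_lower:
  fixes g :: "'a::real_inner \<Rightarrow> real"
  assumes "convex_on UNIV g" "GDERIV g x :> D"
  shows "g x + (z - x) \<bullet> D \<le> g z"
proof -
  define \<phi> where "\<phi> t = g (x + t *\<^sub>R (z - x))" for t :: real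
  have "convex_on UNIV \<phi>"
  proof (rule convex_onI)
    fix t a b :: real assume t: "0 < t" "t < 1"
    have "x + ((1 - t) *\<^sub>R a + t *\<^sub>R b) *\<^sub>R (z - x)
        = (1 - t) *\<^sub>R (x + a *\<^sub>R (z - x)) + t *\<^sub>R (x + b *\<^sub>R (z - x))"
      by (simp add: algebra_simps)
    then show "\<phi> ((1 - t) *\<^sub>R a + t *\<^sub>R b) \<le> (1 - t) * \<phi> a + t * \<phi> b"
      using convex_onD[OF assms(1), of t "x + a *\<^sub>R (z - x)" "x + b *\<^sub>R (z - x)"] t
      by (simp add: \<phi>_def)
  qed simp
  moreover have "(\<phi> has_real_derivative (z - x) \<bullet> D) (at 0)"
    unfolding \<phi>_def using assms(2) by (intro GDERIV_compose_line) simp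
  ultimately have "\<phi> 1 - \<phi> 0 \<ge> ((z - x) \<bullet> D) * (1 - 0)"
    by (intro convex_on_imp_above_tangent) auto
  then show ?thesis
    by (simp add: \<phi>_def)
qed

lemma GDERIV_lipschitz_upper:
  fixes g :: "'a::real_inner \<Rightarrow> real"
  assumes der: "\<And>x. GDERIV g x :> G x"
    and lip: "\<And>x z. norm (G x - G z) \<le> r * norm (x - z)"
  shows "g z \<le> g x + (z - x) \<bullet> G x + r / 2 * (norm (z - x))\<^sup>2"
proof -
  define d where "d = z - x"
  \<comment> \<open>Along the segment, \<open>\<phi>\<close> is \<open>g\<close> minus the linear
    and quadratic terms of its majorant. Its derivative is nonpositive by Cauchy-Schwarz and the
    Lipschitz bound.\<close>
  define \<phi> where "\<phi> t = g (x + t *\<^sub>R d) - t * (d \<bullet> G x) - r / 2 * t\<^sup>2 * (norm d)\<^sup>2" for t :: real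
  have "\<phi> 1 \<le> \<phi> 0"
  proof (rule DERIV_nonpos_imp_nonincreasing[of 0 1 \<phi>])
    fix t :: real assume t: "0 \<le> t" "t \<le> 1"
    have "d \<bullet> (G (x + t *\<^sub>R d) - G x) \<le> norm d * norm (G (x + t *\<^sub>R d) - G x)"
      by (rule norm_cauchy_schwarz)
    also have "\<dots> \<le> norm d * (r * norm (t *\<^sub>R d))"
      using lip[of "x + t *\<^sub>R d" x] by (intro mult_left_mono) auto
    finally have "d \<bullet> G (x + t *\<^sub>R d) - d \<bullet> G x - r * t * (norm d)\<^sup>2 \<le> 0"
      using t by (simp add: inner_diff_right power2_eq_square algebra_simps)
    moreover have "(\<phi> has_real_derivative d \<bullet> G (x + t *\<^sub>R d) - d \<bullet> G x - r * t * (norm d)\<^sup>2) (at t)"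
      unfolding \<phi>_def
      by (rule derivative_eq_intros GDERIV_compose_line der refl | simp)+
    ultimately show "\<exists>y. (\<phi> has_real_derivative y) (at t) \<and> y \<le> 0"
      by blast
  qed simp
  then show ?thesis
    by (simp add: \<phi>_def d_def)
qed

lemma GDERIV_lipschitz_lower:
  fixes g :: "'a::real_inner \<Rightarrow> real"
  assumes der: "\<And>x. GDERIV g x :> G x"
    and lip: "\<And>x z. norm (G x - G z) \<le> r * norm (x - z)"
  shows "g x + (z - x) \<bullet> G x - r / 2 * (norm (z - x))\<^sup>2 \<le> g z"
proof -
  have "norm (- G x - - G z) \<le> r * norm (x - z)" for x z
    using lip[of x z] by (simp add: norm_minus_commute)
  from GDERIV_lipschitz_upper[of "\<lambda>x. - g x" "\<lambda>x. - G x", OF GDERIV_minus[OF der] this, of z x]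
  show ?thesis
    by simp
qed

lemma norm_gradient_bound:
  fixes g :: "'a::real_inner \<Rightarrow> real"
  assumes der: "\<And>x. GDERIV g x :> G x"
    and lip: "\<And>x z. norm (G x - G z) \<le> r * norm (x - z)"
    and "r > 0" and lower: "\<And>z. B \<le> g z"
  shows "(norm (G x))\<^sup>2 \<le> 2 * r * (g x - B)"
proof -
  \<comment> \<open>A gradient step of length \<open>1 / r\<close> minimizes the quadratic majorant
    of \<open>g\<close> at \<open>x\<close>; the value there cannot fall below
    \<open>B\<close>.\<close>
  let ?z = "x - (1 / r) *\<^sub>R G x"
  have "B \<le> g x + (?z - x) \<bullet> G x + r / 2 * (norm (?z - x))\<^sup>2"
    using lower[of ?z] GDERIV_lipschitz_upper[of g G, OF der lip, of ?z x] by linarith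
  also have "\<dots> = g x - (norm (G x))\<^sup>2 / (2 * r)"
    using \<open>r > 0\<close> by (simp add: power2_norm_eq_inner[symmetric] power_divide field_simps power2_eq_square)
  finally show ?thesis
    using \<open>r > 0\<close> by (simp add: field_simps)
qed

subsection \<open>Square-summable sequences\<close>

lemma power2_add_le: "(a + b)\<^sup>2 \<le> 2 * a\<^sup>2 + 2 * (b::real)\<^sup>2"
  using zero_le_power2[of "a - b"] by (simp add: power2_eq_square algebra_simps)

lemma summable_norm_power2_dominated:
  fixes v :: "nat \<Rightarrow> 'a::real_normed_vector" and u :: "nat \<Rightarrow> 'b::real_normed_vector"
  assumes "summable (\<lambda>k. (norm (u k))\<^sup>2)"
    and "\<And>k. k \<ge> N \<Longrightarrow> norm (v k) \<le> C * norm (u k)"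
  shows "summable (\<lambda>k. (norm (v k))\<^sup>2)"
proof (rule summable_comparison_test')
  show "summable (\<lambda>k. C\<^sup>2 * (norm (u k))\<^sup>2)"
    using assms(1) by (rule summable_mult)
  show "norm ((norm (v k))\<^sup>2) \<le> C\<^sup>2 * (norm (u k))\<^sup>2" if "k \<ge> N" for k
    using power_mono[OF assms(2)[OF that], of 2] by (simp add: power_mult_distrib)
qed

lemma summable_norm_power2_add:
  fixes u v :: "nat \<Rightarrow> 'a::real_normed_vector"
  assumes "summable (\<lambda>k. (norm (u k))\<^sup>2)" "summable (\<lambda>k. (norm (v k))\<^sup>2)"
  shows "summable (\<lambda>k. (norm (u k + v k))\<^sup>2)"
proof (rule summable_comparison_test')
  show "summable (\<lambda>k. 2 * (norm (u k))\<^sup>2 + 2 * (norm (v k))\<^sup>2)"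
    using assms by (intro summable_add summable_mult)
  show "norm ((norm (u k + v k))\<^sup>2) \<le> 2 * (norm (u k))\<^sup>2 + 2 * (norm (v k))\<^sup>2" for k
    using order_trans[OF power_mono[OF norm_triangle_ineq norm_ge_zero] power2_add_le] by simp
qed

lemma summable_norm_power2_sum:
  fixes u :: "'i \<Rightarrow> nat \<Rightarrow> 'a::real_normed_vector"
  assumes "\<And>i. i \<in> A \<Longrightarrow> summable (\<lambda>k. (norm (u i k))\<^sup>2)"
  shows "summable (\<lambda>k. (norm (\<Sum>i\<in>A. u i k))\<^sup>2)"
  using assms by (induction A rule: infinite_finite_induct) (auto intro: summable_norm_power2_add)

lemma summable_norm_power2_imp_tendsto_0:
  fixes u :: "nat \<Rightarrow> 'a::real_normed_vector"
  assumes "summable (\<lambda>k. (norm (u k))\<^sup>2)"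
  shows "u \<longlonglongrightarrow> 0"
proof -
  have "(\<lambda>k. sqrt ((norm (u k))\<^sup>2)) \<longlonglongrightarrow> sqrt 0"
    using summable_LIMSEQ_zero[OF assms] by (rule tendsto_real_sqrt)
  then show ?thesis
    by (simp add: tendsto_norm_zero_iff)
qed

text \<open>The difference telescopes into \<open>j\<close> steps, and Cauchy-Schwarz trades the sum
  of their lengths for the root of the sum of squares at the price of a factor
  \<open>sqrt j\<close>.\<close>

lemma norm_diff_le_sqrt:
  fixes Y :: "nat \<Rightarrow> 'a::real_normed_vector"
  assumes "summable (\<lambda>j. (norm (Y (Suc j) - Y j))\<^sup>2)"
  shows "norm (Y j - Y 0) \<le> sqrt (\<Sum>j. (norm (Y (Suc j) - Y j))\<^sup>2) * sqrt j"
proof -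
  have "norm (Y j - Y 0) = norm (\<Sum>k<j. Y (Suc k) - Y k)"
    by (simp add: sum_lessThan_telescope)
  also have "\<dots> \<le> (\<Sum>k<j. norm (Y (Suc k) - Y k))"
    by (rule norm_sum)
  finally have "(norm (Y j - Y 0))\<^sup>2 \<le> (\<Sum>k<j. norm (Y (Suc k) - Y k))\<^sup>2"
    by (intro power_mono) auto
  also have "\<dots> \<le> (\<Sum>k<j. (norm (Y (Suc k) - Y k))\<^sup>2) * real j"
    using sum_squared_le_sum_of_squares[of "\<lambda>k. norm (Y (Suc k) - Y k)" "{..<j}"] by simp
  also have "\<dots> \<le> (\<Sum>j. (norm (Y (Suc j) - Y j))\<^sup>2) * real j"
    using assms by (intro mult_right_mono sum_le_suminf) auto
  finally show ?thesis
    by (metis real_le_rsqrt real_sqrt_mult)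
qed

text \<open>A positive limit \<open>c\<close> would force \<open>(norm (g j))\<^sup>2\<close> to dominate a multiple of \<open>1 / j\<close>, because
  \<open>norm (Y j - z)\<close> is only \<open>O(sqrt j)\<close>.\<close>

lemma limit_nonpos_of_square_summable:
  fixes Y :: "nat \<Rightarrow> 'a::real_normed_vector" and g :: "nat \<Rightarrow> 'b::real_normed_vector"
  assumes Y: "summable (\<lambda>j. (norm (Y (Suc j) - Y j))\<^sup>2)"
    and g: "summable (\<lambda>j. (norm (g j))\<^sup>2)"
    and d: "\<And>j. d j \<le> norm (g j) * norm (Y j - z)"
    and lim: "d \<longlonglongrightarrow> c"
  shows "c \<le> 0"
proof (rule ccontr)
  assume "\<not> c \<le> 0"
  then have c: "c > 0" by simp
  \<comment> \<open>For \<open>j \<ge> 1\<close> the initial distance is at most itself times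
    \<open>sqrt j\<close>, so one constant covers both contributions.\<close>
  define M where "M = norm (Y 0 - z) + sqrt (\<Sum>j. (norm (Y (Suc j) - Y j))\<^sup>2)"
  have M: "norm (Y j - z) \<le> M * sqrt j" if "j \<ge> 1" for j
  proof -
    have "norm (Y j - z) \<le> norm (Y 0 - z) + norm (Y j - Y 0)"
      using norm_triangle_ineq[of "Y j - Y 0" "Y 0 - z"] by simp
    moreover have "norm (Y 0 - z) * 1 \<le> norm (Y 0 - z) * sqrt j"
      using that by (intro mult_left_mono) auto
    ultimately show ?thesis
      using norm_diff_le_sqrt[OF Y, of j] by (simp add: M_def algebra_simps)
  qed
  have half: "\<forall>\<^sub>F j in sequentially. c / 2 < d j"
    using lim c by (intro order_tendstoD(1)) auto
  have "\<forall>\<^sub>F j in sequentially. norm (inverse (real j)) \<le> (2 * M / c)\<^sup>2 * (norm (g j))\<^sup>2"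
    using half eventually_ge_at_top[of 1]
  proof eventually_elim
    case (elim j)
    have "c / 2 \<le> norm (g j) * (M * sqrt j)"
      using elim c d[of j] mult_left_mono[OF M[of j], of "norm (g j)"] by simp
    then have "(c / 2)\<^sup>2 \<le> (norm (g j) * (M * sqrt j))\<^sup>2"
      using c by (intro power_mono) auto
    then show ?case
      using elim c by (simp add: power_mult_distrib power_divide field_simps)
  qed
  moreover have "summable (\<lambda>j. (2 * M / c)\<^sup>2 * (norm (g j))\<^sup>2)"
    using g by (rule summable_mult)
  ultimately have "summable (\<lambda>j. inverse (real j))"
    by (rule summable_comparison_test_ev)
  then show False
    using not_summable_harmonic[where ?'a = real] by simp
qed

text \<open>The hypothesis says that \<open>c\<close> is the stationary point of the quadratic
  function of \<open>z\<close> on the left. The linear term in \<open>z - c\<close> therefore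
  vanishes and the expansion around \<open>c\<close> is exact.\<close>

lemma weighted_sum_quadratic:
  fixes x p :: "'i \<Rightarrow> 'a::real_inner" and s :: "'i \<Rightarrow> real"
  assumes "(\<Sum>i\<in>A. s i) *\<^sub>R c = (\<Sum>i\<in>A. s i *\<^sub>R x i) + (\<Sum>i\<in>A. p i)"
  shows "(\<Sum>i\<in>A. (x i - z) \<bullet> p i + s i / 2 * (norm (x i - z))\<^sup>2)
       = (\<Sum>i\<in>A. (x i - c) \<bullet> p i + s i / 2 * (norm (x i - c))\<^sup>2)
         + (\<Sum>i\<in>A. s i) / 2 * (norm (z - c))\<^sup>2"
proof -
  have "(x i - z) \<bullet> p i + s i / 2 * (norm (x i - z))\<^sup>2
      = (x i - c) \<bullet> p i + s i / 2 * (norm (x i - c))\<^sup>2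
        + s i / 2 * (norm (z - c))\<^sup>2 - (z - c) \<bullet> (s i *\<^sub>R x i + p i - s i *\<^sub>R c)" for i
    by (simp add: power2_norm_eq_inner inner_commute algebra_simps)
  then have "(\<Sum>i\<in>A. (x i - z) \<bullet> p i + s i / 2 * (norm (x i - z))\<^sup>2)
      = (\<Sum>i\<in>A. (x i - c) \<bullet> p i + s i / 2 * (norm (x i - c))\<^sup>2)
        + (\<Sum>i\<in>A. s i / 2 * (norm (z - c))\<^sup>2)
        - (z - c) \<bullet> (\<Sum>i\<in>A. s i *\<^sub>R x i + p i - s i *\<^sub>R c)"
    by (simp add: sum.distrib sum_subtractf inner_sum_right[symmetric])
  moreover have "(\<Sum>i\<in>A. s i *\<^sub>R x i + p i - s i *\<^sub>R c) = 0"
    using assms by (simp add: sum.distrib sum_subtractf scaleR_sum_left)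
  ultimately show ?thesis
    by (simp add: sum_distrib_right sum_divide_distrib)
qed

subsection \<open>Descent of the augmented Lagrangian\<close>

locale ceadmm =
  fixes w r \<sigma> :: "'m::finite \<Rightarrow> real"
    and f :: "'m \<Rightarrow> real^'n \<Rightarrow> real"
    and k0 :: nat
    and y :: "nat \<Rightarrow> real^'n"
    and X P :: "nat \<Rightarrow> real^'n^'m"
    and xstar :: "real^'n"
  assumes w_pos: "\<And>i. w i > 0"
    and f_bdd: "\<And>i. bdd_below (range (f i))"
    and xstar_min: "minimizer (objective w f) xstar"
    and r_pos: "\<And>i. r i > 0"
    and f_lip: "\<And>i. gradient_lipschitz (r i) (f i)"
    and sigma_pos: "\<And>i. \<sigma> i > 0"
    and sigma_gt: "\<And>i. \<sigma> i > 2 * w i * r i"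
    and k0_pos: "k0 > 0"
    and gen: "ceadmm_sequence w f \<sigma> k0 y X P"
    and f_convex: "convex_on UNIV (objective w f)"
begin

abbreviation wgrad where
  "wgrad i x \<equiv> w i *\<^sub>R grad (f i) x"

abbreviation lagr where
  "lagr k \<equiv> aug_lagrangian w f \<sigma> (y k) (X k) (P k)"

definition sigma_sum where
  "sigma_sum = (\<Sum>i\<in>UNIV. \<sigma> i)"

text \<open>This is the strong convexity gain \<open>(\<sigma> i - w i * r i) / 2\<close> of the local minimization minus the loss
  \<open>(w i * r i)\<^sup>2 / \<sigma> i\<close> of the multiplier update.\<close>

definition decay where
  "decay i = (\<sigma> i - 2 * (w i * r i)) * (\<sigma> i + w i * r i) / (2 * \<sigma> i)"

lemma sigma_sum_pos: "sigma_sum > 0"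
  unfolding sigma_sum_def by (intro sum_pos) (auto simp: sigma_pos)

lemma wr_pos: "w i * r i > 0"
  using w_pos r_pos by simp

lemma decay_pos: "decay i > 0"
  unfolding decay_def using sigma_pos[of i] sigma_gt[of i] wr_pos[of i] by (simp add: mult.assoc)

lemma grad_lipschitz: "norm (grad (f i) x - grad (f i) z) \<le> r i * norm (x - z)"
  using f_lip[of i] by (simp add: gradient_lipschitz_def)

lemma f_GDERIV: "GDERIV (f i) x :> grad (f i) x"
  using f_lip[of i] by (intro gderiv_grad) (simp add: gradient_lipschitz_def)

lemma wgrad_GDERIV: "GDERIV (\<lambda>x. w i * f i x) x :> wgrad i x"
  by (intro GDERIV_cmult f_GDERIV)

lemma wgrad_lipschitz: "norm (wgrad i x - wgrad i z) \<le> (w i * r i) * norm (x - z)"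
  using mult_left_mono[OF grad_lipschitz[of i x z], of "w i"] w_pos[of i]
  by (simp add: scaleR_diff_right[symmetric] mult.assoc)

lemma objective_GDERIV: "GDERIV (objective w f) x :> (\<Sum>i\<in>UNIV. wgrad i x)"
  unfolding objective_def[abs_def] by (intro GDERIV_sum wgrad_GDERIV)

lemma grad_tendsto:
  assumes "(g \<longlongrightarrow> x) F"
  shows "((\<lambda>k. grad (f i) (g k)) \<longlongrightarrow> grad (f i) x) F"
proof -
  have "((\<lambda>k. grad (f i) (g k) - grad (f i) x) \<longlongrightarrow> 0) F"
  proof (rule Lim_null_comparison)
    show "eventually (\<lambda>k. norm (grad (f i) (g k) - grad (f i) x) \<le> r i * norm (g k - x)) F"
      by (intro always_eventually allI grad_lipschitz)
    show "((\<lambda>k. r i * norm (g k - x)) \<longlongrightarrow> 0) F"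
      using assms by (intro tendsto_mult_right_zero tendsto_norm_zero) (simp add: LIM_zero_iff)
  qed
  then show ?thesis
    by (simp add: LIM_zero_iff)
qed

lemma objective_tendsto:
  assumes "(g \<longlongrightarrow> x) F"
  shows "((\<lambda>k. objective w f (g k)) \<longlongrightarrow> objective w f x) F"
proof -
  have "isCont (objective w f) x"
    using objective_GDERIV[of x] by (auto simp: gderiv_def intro: has_derivative_continuous)
  then show ?thesis
    using assms by (rule isCont_tendsto_compose)
qed

lemma objective_ge: "objective w f xstar \<le> objective w f x"
  using xstar_min by (simp add: minimizer_def is_arg_min_linorder)

lemma minimizer_iff: "minimizer (objective w f) x \<longleftrightarrow> objective w f x = objective w f xstar"
  using objective_ge by (auto simp: minimizer_def is_arg_min_linorder intro: antisym)

text \<open>With the multiplier \<open>- wgrad i z\<close>, the first two terms of the local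
  Lagrangian form the first-order Taylor polynomial of \<open>w i * f i\<close> at \<open>z\<close>,
  evaluated at \<open>x\<close>. Its error is at most \<open>w i * r i / 2\<close> times the squared
  distance.\<close>

lemma local_lagrangian_bounds:
  shows "w i * f i x + (\<sigma> i - w i * r i) / 2 * (norm (z - x))\<^sup>2
           \<le> local_lagrangian w f \<sigma> i x z (- wgrad i z)"
    and "local_lagrangian w f \<sigma> i x z (- wgrad i z)
           \<le> w i * f i x + (\<sigma> i + w i * r i) / 2 * (norm (z - x))\<^sup>2"
proof -
  have [simp]: "(x - z) \<bullet> grad (f i) z = - ((z - x) \<bullet> grad (f i) z)"
    by (metis inner_minus_left minus_diff_eq)
  show "w i * f i x + (\<sigma> i - w i * r i) / 2 * (norm (z - x))\<^sup>2
           \<le> local_lagrangian w f \<sigma> i x z (- wgrad i z)"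
    using GDERIV_lipschitz_upper[of "\<lambda>x. w i * f i x" "wgrad i", OF wgrad_GDERIV wgrad_lipschitz, of x z]
    by (simp add: local_lagrangian_def norm_minus_commute[of x z] diff_divide_distrib left_diff_distrib)
  show "local_lagrangian w f \<sigma> i x z (- wgrad i z)
           \<le> w i * f i x + (\<sigma> i + w i * r i) / 2 * (norm (z - x))\<^sup>2"
    using GDERIV_lipschitz_lower[of "\<lambda>x. w i * f i x" "wgrad i", OF wgrad_GDERIV wgrad_lipschitz, of z x]
    by (simp add: local_lagrangian_def norm_minus_commute[of x z] add_divide_distrib distrib_right)
qed

lemma local_lagrangian_GDERIV:
  "GDERIV (\<lambda>z. local_lagrangian w f \<sigma> i x z p) z :> wgrad i z + p + \<sigma> i *\<^sub>R (z - x)"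
proof -
  have "GDERIV (\<lambda>z. (z - x) \<bullet> p) z :> p"
    unfolding gderiv_def by (auto intro!: derivative_eq_intros)
  moreover have "GDERIV (\<lambda>z. \<sigma> i / 2 * (norm (z - x))\<^sup>2) z :> \<sigma> i *\<^sub>R (z - x)"
    unfolding gderiv_def power2_norm_eq_inner
    by (auto intro!: derivative_eq_intros simp: inner_commute)
  ultimately show ?thesis
    unfolding local_lagrangian_def by (intro GDERIV_add wgrad_GDERIV)
qed

text \<open>The auxiliary sequence \<open>x\<close> is hidden under an existential quantifier. The
  elimination form exposes all rules of a round for the same \<open>x\<close>, which links the
  aggregation to \<open>y\<close>.\<close>

lemma stepE:
  obtains x where
    "\<And>k. k0 dvd k \<Longrightarrow> x (Suc k) = (\<Sum>i\<in>UNIV. (\<sigma> i / sigma_sum) *\<^sub>R X k $ i)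
       + (1 / sigma_sum) *\<^sub>R (\<Sum>i\<in>UNIV. P k $ i)"
    and "\<And>k. y (Suc k) = x (Suc (k div k0 * k0))"
    and "\<And>k i. minimizer (\<lambda>z. local_lagrangian w f \<sigma> i (y (Suc k)) z (P k $ i)) (X (Suc k) $ i)"
    and "\<And>k i. P (Suc k) $ i = P k $ i + \<sigma> i *\<^sub>R (X (Suc k) $ i - y (Suc k))"
proof -
  from gen[unfolded ceadmm_sequence_def Suc_eq_plus1[symmetric], folded sigma_sum_def] obtain x
    where "\<forall>k. (k0 dvd k \<longrightarrow> x (Suc k) = (\<Sum>i\<in>UNIV. (\<sigma> i / sigma_sum) *\<^sub>R X k $ i)
          + (1 / sigma_sum) *\<^sub>R (\<Sum>i\<in>UNIV. P k $ i))
        \<and> y (Suc k) = x (Suc (k div k0 * k0))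
        \<and> (\<forall>i. minimizer (\<lambda>z. local_lagrangian w f \<sigma> i (y (Suc k)) z (P k $ i)) (X (Suc k) $ i)
            \<and> P (Suc k) $ i = P k $ i + \<sigma> i *\<^sub>R (X (Suc k) $ i - y (Suc k)))"
    by (rule exE)
  note x = this[THEN spec]
  show thesis
    by (rule that[of x, OF x[THEN conjunct1, THEN mp] x[THEN conjunct2, THEN conjunct1]
          x[THEN conjunct2, THEN conjunct2, THEN spec, THEN conjunct1]
          x[THEN conjunct2, THEN conjunct2, THEN spec, THEN conjunct2]])
qed

lemma step_minimizer:
  "minimizer (\<lambda>z. local_lagrangian w f \<sigma> i (y (Suc k)) z (P k $ i)) (X (Suc k) $ i)"
  by (rule stepE) blast

lemma multiplier_step: "P (Suc k) $ i = P k $ i + \<sigma> i *\<^sub>R (X (Suc k) $ i - y (Suc k))"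
  by (rule stepE) blast

text \<open>This is the stationarity condition of the local minimization: the multiplier update
  absorbs exactly the gradient of the penalty. It starts at index 1, since \<open>P 0\<close> is
  arbitrary.\<close>

lemma multiplier_eq: "P (Suc k) $ i = - wgrad i (X (Suc k) $ i)"
proof -
  have "wgrad i (X (Suc k) $ i) + P (Suc k) $ i = 0"
    using GDERIV_minimizer_eq_0[OF local_lagrangian_GDERIV step_minimizer[of i k]]
    by (simp only: multiplier_step add.assoc)
  then show ?thesis
    by (simp only: eq_neg_iff_add_eq_0 add.commute)
qed

lemma y_between:
  assumes "\<not> k0 dvd Suc k"
  shows "y (Suc (Suc k)) = y (Suc k)"
proof -
  have "Suc k div k0 = k div k0"
    using assms by (metis div_Suc dvd_eq_mod_eq_0)
  moreover obtain x where "\<And>k. y (Suc k) = x (Suc (k div k0 * k0))"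
    by (rule stepE) blast
  ultimately show ?thesis
    by simp
qed

text \<open>Cleared of the division by \<open>sigma_sum\<close>, the aggregation formula is the
  hypothesis of \<open>weighted_sum_quadratic\<close>.\<close>

lemma y_communication:
  assumes "k0 dvd k"
  shows "sigma_sum *\<^sub>R y (Suc k) = (\<Sum>i\<in>UNIV. \<sigma> i *\<^sub>R X k $ i) + (\<Sum>i\<in>UNIV. P k $ i)"
proof -
  obtain x where "\<And>k. k0 dvd k \<Longrightarrow> x (Suc k) = (\<Sum>i\<in>UNIV. (\<sigma> i / sigma_sum) *\<^sub>R X k $ i)
      + (1 / sigma_sum) *\<^sub>R (\<Sum>i\<in>UNIV. P k $ i)"
    and "\<And>k. y (Suc k) = x (Suc (k div k0 * k0))"
    by (rule stepE) blast
  then have "y (Suc k) = (\<Sum>i\<in>UNIV. (\<sigma> i / sigma_sum) *\<^sub>R X k $ i)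
      + (1 / sigma_sum) *\<^sub>R (\<Sum>i\<in>UNIV. P k $ i)"
    using assms by simp
  then show ?thesis
    using sigma_sum_pos by (simp add: scaleR_add_right scaleR_sum_right)
qed

text \<open>At a communication round the new \<open>y\<close> is the exact minimizer of the
  Lagrangian in its first argument, a quadratic with curvature \<open>sigma_sum\<close>; in all
  other rounds \<open>y\<close> does not move.\<close>

lemma aug_lagrangian_y_step:
  assumes "k \<ge> 1"
  shows "aug_lagrangian w f \<sigma> (y (Suc k)) (X k) (P k)
           + sigma_sum / 2 * (norm (y (Suc k) - y k))\<^sup>2 = lagr k"
proof (cases "k0 dvd k")
  case True
  from weighted_sum_quadratic[OF y_communication[OF True, unfolded sigma_sum_def], of "y k"]
  show ?thesis
    by (simp add: aug_lagrangian_def local_lagrangian_def sigma_sum_def sum.distrib add.assoc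
        norm_minus_commute[of "y k"])
next
  case False
  then show ?thesis
    using y_between[of "k - 1"] assms by simp
qed

text \<open>Expanding around the new point, stationarity cancels the linear part. The penalty
  contributes curvature \<open>\<sigma> i\<close>, of which the possibly nonconvex
  \<open>f i\<close> destroys at most \<open>w i * r i\<close>.\<close>

lemma local_lagrangian_x_step:
  "local_lagrangian w f \<sigma> i (y (Suc k)) (X (Suc k) $ i) (P k $ i)
     + (\<sigma> i - w i * r i) / 2 * (norm (X (Suc k) $ i - X k $ i))\<^sup>2
   \<le> local_lagrangian w f \<sigma> i (y (Suc k)) (X k $ i) (P k $ i)"
proof -
  let ?y = "y (Suc k)" and ?u = "X (Suc k) $ i" and ?v = "X k $ i" and ?p = "P k $ i"
  have wg: "wgrad i ?u = - (?p + \<sigma> i *\<^sub>R (?u - ?y))"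
    by (simp only: multiplier_step[symmetric] multiplier_eq minus_minus)
  have "w i * f i ?u + (?v - ?u) \<bullet> wgrad i ?u - (w i * r i) / 2 * (norm (?v - ?u))\<^sup>2 \<le> w i * f i ?v"
    by (rule GDERIV_lipschitz_lower[of "\<lambda>x. w i * f i x" "wgrad i", OF wgrad_GDERIV wgrad_lipschitz])
  moreover have "(?v - ?u) \<bullet> wgrad i ?u = (?u - ?y) \<bullet> ?p + \<sigma> i / 2 * (norm (?u - ?y))\<^sup>2
      - (?v - ?y) \<bullet> ?p - \<sigma> i / 2 * (norm (?v - ?y))\<^sup>2 + \<sigma> i / 2 * (norm (?v - ?u))\<^sup>2"
    unfolding wg by (simp add: power2_norm_eq_inner inner_commute algebra_simps)
  ultimately show ?thesis
    by (simp add: local_lagrangian_def norm_minus_commute[of ?u ?v] diff_divide_distrib left_diff_distrib)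
qed

text \<open>The increment of the multiplier is read in two ways: from its update, and as a
  difference of weighted gradients. The second reading needs \<open>k \<ge> 1\<close>, so that
  \<open>P k\<close> is a negative gradient too.\<close>

lemma norm_multiplier_diff:
  assumes "k \<ge> 1"
  shows "\<sigma> i * norm (X (Suc k) $ i - y (Suc k)) \<le> w i * r i * norm (X (Suc k) $ i - X k $ i)"
proof -
  have "\<sigma> i * norm (X (Suc k) $ i - y (Suc k)) = norm (P (Suc k) $ i - P k $ i)"
    using sigma_pos[of i] by (simp add: multiplier_step)
  also have "\<dots> = norm (wgrad i (X (Suc k) $ i) - wgrad i (X k $ i))"
    using multiplier_eq[of k i] multiplier_eq[of "k - 1" i] assms by (simp add: norm_minus_commute)
  also have "\<dots> \<le> w i * r i * norm (X (Suc k) $ i - X k $ i)"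
    by (rule wgrad_lipschitz)
  finally show ?thesis .
qed

text \<open>The multiplier update raises the local Lagrangian by exactly \<open>\<sigma> i\<close>
  times the squared consensus gap, which \<open>norm_multiplier_diff\<close> controls by the local
  step.\<close>

lemma local_lagrangian_multiplier_step:
  assumes "k \<ge> 1"
  shows "local_lagrangian w f \<sigma> i (y (Suc k)) (X (Suc k) $ i) (P (Suc k) $ i)
    \<le> local_lagrangian w f \<sigma> i (y (Suc k)) (X (Suc k) $ i) (P k $ i)
      + (w i * r i)\<^sup>2 / \<sigma> i * (norm (X (Suc k) $ i - X k $ i))\<^sup>2"
proof -
  let ?n = "norm (X (Suc k) $ i - y (Suc k))"
  have "(\<sigma> i * ?n)\<^sup>2 \<le> (w i * r i * norm (X (Suc k) $ i - X k $ i))\<^sup>2"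
    using norm_multiplier_diff[OF assms, of i] sigma_pos[of i] by (intro power_mono) auto
  then have "\<sigma> i * ?n\<^sup>2 \<le> (w i * r i)\<^sup>2 / \<sigma> i * (norm (X (Suc k) $ i - X k $ i))\<^sup>2"
    using sigma_pos[of i] by (simp add: field_simps power2_eq_square)
  moreover have "local_lagrangian w f \<sigma> i (y (Suc k)) (X (Suc k) $ i) (P (Suc k) $ i)
      = local_lagrangian w f \<sigma> i (y (Suc k)) (X (Suc k) $ i) (P k $ i) + \<sigma> i * ?n\<^sup>2"
    by (simp add: local_lagrangian_def multiplier_step inner_add_right power2_norm_eq_inner)
  ultimately show ?thesis
    by linarith
qed

text \<open>The updates of \<open>y\<close>, the local copies and the multipliers are taken in this
  order. The first two lower the Lagrangian and the third raises it; \<open>decay i\<close> is the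
  net coefficient of the squared local step.\<close>

lemma lagr_descent:
  assumes "k \<ge> 1"
  shows "lagr (Suc k) + sigma_sum / 2 * (norm (y (Suc k) - y k))\<^sup>2
      + (\<Sum>i\<in>UNIV. decay i * (norm (X (Suc k) $ i - X k $ i))\<^sup>2) \<le> lagr k"
proof -
  have "local_lagrangian w f \<sigma> i (y (Suc k)) (X (Suc k) $ i) (P (Suc k) $ i)
      + decay i * (norm (X (Suc k) $ i - X k $ i))\<^sup>2
    \<le> local_lagrangian w f \<sigma> i (y (Suc k)) (X k $ i) (P k $ i)" for i
  proof -
    have "decay i = (\<sigma> i - w i * r i) / 2 - (w i * r i)\<^sup>2 / \<sigma> i"
      unfolding decay_def using sigma_pos[of i] by (simp add: field_simps power2_eq_square)
    then show ?thesis
      using local_lagrangian_x_step[where k = k and i = i]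
        local_lagrangian_multiplier_step[OF assms, where i = i]
      by (simp add: left_diff_distrib)
  qed
  then have "lagr (Suc k) + (\<Sum>i\<in>UNIV. decay i * (norm (X (Suc k) $ i - X k $ i))\<^sup>2)
      \<le> aug_lagrangian w f \<sigma> (y (Suc k)) (X k) (P k)"
    unfolding aug_lagrangian_def sum.distrib[symmetric] by (intro sum_mono)
  then show ?thesis
    using aug_lagrangian_y_step[OF assms] by simp
qed

lemma objective_le_lagr: "objective w f (y (Suc k)) \<le> lagr (Suc k)"
  unfolding objective_def aug_lagrangian_def multiplier_eq
proof (intro sum_mono)
  fix i
  have "0 \<le> (\<sigma> i - w i * r i) / 2 * (norm (X (Suc k) $ i - y (Suc k)))\<^sup>2"
    using sigma_gt[of i] wr_pos[of i] by (intro mult_nonneg_nonneg) auto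
  then show "w i * f i (y (Suc k))
      \<le> local_lagrangian w f \<sigma> i (y (Suc k)) (X (Suc k) $ i) (- wgrad i (X (Suc k) $ i))"
    using local_lagrangian_bounds(1)[of i "y (Suc k)" "X (Suc k) $ i"] by linarith
qed

text \<open>Together with \<open>objective_le_lagr\<close> this confines the difference between the
  Lagrangian and the objective at \<open>y\<close> to the squared consensus gaps.\<close>

lemma lagr_le_objective:
  "lagr (Suc k) \<le> objective w f (y (Suc k))
     + (\<Sum>i\<in>UNIV. (\<sigma> i + w i * r i) / 2 * (norm (X (Suc k) $ i - y (Suc k)))\<^sup>2)"
  unfolding objective_def aug_lagrangian_def multiplier_eq sum.distrib[symmetric]
  by (intro sum_mono local_lagrangian_bounds)

subsection \<open>Convergence\<close>

text \<open>The decrease of the Lagrangian that \<open>lagr_descent\<close> guarantees in round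
  \<open>k\<close>, provided \<open>k \<ge> 1\<close>.\<close>

definition energy where
  "energy k = sigma_sum / 2 * (norm (y (Suc k) - y k))\<^sup>2
     + (\<Sum>i\<in>UNIV. decay i * (norm (X (Suc k) $ i - X k $ i))\<^sup>2)"

lemma decay_term_nonneg: "0 \<le> decay i * (norm v)\<^sup>2"
  using decay_pos[of i] by simp

lemma y_step_le_energy: "sigma_sum / 2 * (norm (y (Suc k) - y k))\<^sup>2 \<le> energy k"
  unfolding energy_def by (simp add: sum_nonneg decay_term_nonneg)

lemma x_step_le_energy: "decay i * (norm (X (Suc k) $ i - X k $ i))\<^sup>2 \<le> energy k"
proof -
  have "decay i * (norm (X (Suc k) $ i - X k $ i))\<^sup>2
      \<le> (\<Sum>i\<in>UNIV. decay i * (norm (X (Suc k) $ i - X k $ i))\<^sup>2)"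
    by (rule member_le_sum) (auto simp: decay_term_nonneg)
  then show ?thesis
    using sigma_sum_pos by (simp add: energy_def add_increasing)
qed

lemma energy_nonneg: "energy k \<ge> 0"
  using y_step_le_energy[of k] sigma_sum_pos by (intro order_trans[OF _ y_step_le_energy]) auto

lemma lagr_convergent:
  obtains l where "lagr \<longlonglongrightarrow> l"
proof -
  \<comment> \<open>Monotonicity is claimed from index 1 on only, because the initial data are
    arbitrary.\<close>
  have "lagr (Suc (Suc k)) \<le> lagr (Suc k)" for k
    using lagr_descent[of "Suc k"] energy_nonneg[of "Suc k"] by (simp add: energy_def)
  then have "decseq (\<lambda>k. lagr (Suc k))"
    by (rule decseq_SucI)
  moreover have "\<forall>k. objective w f xstar \<le> lagr (Suc k)"
    using objective_ge objective_le_lagr order_trans by blast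
  ultimately obtain l where "(\<lambda>k. lagr (Suc k)) \<longlonglongrightarrow> l"
    by (rule decseq_convergent)
  then have "lagr \<longlonglongrightarrow> l"
    by (rule LIMSEQ_imp_Suc)
  with that show ?thesis .
qed

lemma summable_energy: "summable energy"
proof -
  obtain l where "lagr \<longlonglongrightarrow> l"
    by (rule lagr_convergent)
  then have "summable (\<lambda>k. lagr k - lagr (Suc k))"
    by (rule telescope_summable')
  then show ?thesis
  proof (rule summable_comparison_test')
    show "norm (energy k) \<le> lagr k - lagr (Suc k)" if "k \<ge> 1" for k
      using lagr_descent[OF that] energy_nonneg[of k] by (simp add: energy_def)
  qed
qed

lemma summable_y_step: "summable (\<lambda>k. (norm (y (Suc k) - y k))\<^sup>2)"
proof (rule summable_comparison_test')
  show "summable (\<lambda>k. 2 / sigma_sum * energy k)"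
    by (intro summable_mult summable_energy)
  show "norm ((norm (y (Suc k) - y k))\<^sup>2) \<le> 2 / sigma_sum * energy k" for k
    using y_step_le_energy[of k] sigma_sum_pos by (simp add: field_simps)
qed

lemma summable_x_step: "summable (\<lambda>k. (norm (X (Suc k) $ i - X k $ i))\<^sup>2)"
proof (rule summable_comparison_test')
  show "summable (\<lambda>k. 1 / decay i * energy k)"
    by (intro summable_mult summable_energy)
  show "norm ((norm (X (Suc k) $ i - X k $ i))\<^sup>2) \<le> 1 / decay i * energy k" for k
    using x_step_le_energy[of i k] decay_pos[of i] by (simp add: field_simps)
qed

lemma summable_consensus_gap: "summable (\<lambda>k. (norm (X k $ i - y k))\<^sup>2)"
proof -
  have "summable (\<lambda>k. (norm (X (Suc k) $ i - y (Suc k)))\<^sup>2)"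
    using summable_x_step[of i]
  proof (rule summable_norm_power2_dominated)
    show "norm (X (Suc k) $ i - y (Suc k)) \<le> w i * r i / \<sigma> i * norm (X (Suc k) $ i - X k $ i)"
      if "k \<ge> 1" for k
      using norm_multiplier_diff[OF that, of i] sigma_pos[of i] by (simp add: field_simps)
  qed
  then show ?thesis
    by (rule summable_Suc_iff[of "\<lambda>k. (norm (X k $ i - y k))\<^sup>2", THEN iffD1])
qed

lemma consensus_gap_tendsto: "(\<lambda>k. X k $ i - y k) \<longlonglongrightarrow> 0"
  by (rule summable_norm_power2_imp_tendsto_0[OF summable_consensus_gap])

lemma lagr_minus_objective_tendsto: "(\<lambda>k. lagr k - objective w f (y k)) \<longlonglongrightarrow> 0"
proof (rule LIMSEQ_imp_Suc)
  let ?u = "\<lambda>k. \<Sum>i\<in>UNIV. (\<sigma> i + w i * r i) / 2 * (norm (X (Suc k) $ i - y (Suc k)))\<^sup>2"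
  have "?u \<longlonglongrightarrow> (\<Sum>i\<in>UNIV. (\<sigma> i + w i * r i) / 2 * (norm (0::real^'n))\<^sup>2)"
    by (intro tendsto_intros LIMSEQ_Suc[OF consensus_gap_tendsto])
  then have u: "?u \<longlonglongrightarrow> 0" by simp
  show "(\<lambda>k. lagr (Suc k) - objective w f (y (Suc k))) \<longlonglongrightarrow> 0"
  proof (rule tendsto_sandwich[OF _ _ tendsto_const u])
    show "\<forall>\<^sub>F k in sequentially. 0 \<le> lagr (Suc k) - objective w f (y (Suc k))"
      using objective_le_lagr by simp
    show "\<forall>\<^sub>F k in sequentially. lagr (Suc k) - objective w f (y (Suc k)) \<le> ?u k"
      using lagr_le_objective by (simp add: algebra_simps)
  qed
qed

section \<open>Gradients of the objective at the communication rounds\<close>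

lemma y_block:
  assumes "j < k0"
  shows "y (Suc (n * k0 + j)) = y (Suc (n * k0))"
  using assms
proof (induction j)
  case (Suc j)
  have "Suc (n * k0 + j) mod k0 = Suc j"
    using Suc.prems by (metis add_Suc_right mod_less mod_mult_self3)
  then have "\<not> k0 dvd Suc (n * k0 + j)"
    by (metis dvd_imp_mod_0 nat.distinct(1))
  then show ?case
    using y_between[of "n * k0 + j"] Suc by simp
qed simp

lemma y_block_end: "y (Suc n * k0) = y (Suc (n * k0))"
  using y_block[of "k0 - 1" n] k0_pos by (simp add: add.commute)

text \<open>By \<open>y_block_end\<close> the increment between consecutive blocks is a single step
  of \<open>y\<close>, so the series is a subseries of \<open>summable_y_step\<close>.\<close>

lemma summable_block_step:
  "summable (\<lambda>n. (norm (y (Suc (Suc n * k0)) - y (Suc (n * k0))))\<^sup>2)"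
proof -
  have "inj (\<lambda>n. Suc n * k0)"
    using k0_pos by (auto simp: inj_def)
  then show ?thesis
    using summable_reindex[OF summable_y_step, of "\<lambda>n. Suc n * k0"]
    by (simp add: o_def y_block_end[symmetric] del: mult_Suc)
qed

text \<open>The aggregation formula says that \<open>y (Suc k)\<close> balances \<open>\<sigma> i *\<^sub>R (X k $ i - y (Suc k))\<close>
  against the multipliers \<open>- wgrad i (X k $ i)\<close>, so the gradient of the objective at
  \<open>y (Suc k)\<close> is a sum of terms of the size of \<open>X k $ i - y (Suc k)\<close>.\<close>

lemma gradient_at_communication:
  assumes "k \<ge> 1" "k0 dvd k"
  shows "(\<Sum>i\<in>UNIV. wgrad i (y (Suc k)))
    = (\<Sum>i\<in>UNIV. (wgrad i (y (Suc k)) - wgrad i (X k $ i)) + \<sigma> i *\<^sub>R (X k $ i - y (Suc k)))"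
proof -
  have "P k $ i = - wgrad i (X k $ i)" for i
    using multiplier_eq[of "k - 1" i] assms(1) by simp
  then have "sigma_sum *\<^sub>R y (Suc k)
      = (\<Sum>i\<in>UNIV. \<sigma> i *\<^sub>R X k $ i) - (\<Sum>i\<in>UNIV. wgrad i (X k $ i))"
    using y_communication[OF assms(2)] by (simp add: sum_negf)
  then show ?thesis
    by (simp add: sum.distrib sum_subtractf scaleR_diff_right scaleR_sum_left[symmetric] sigma_sum_def)
qed

text \<open>The right-hand side of \<open>gradient_at_communication\<close> is square summable over
  all rounds, hence over the multiples of \<open>k0\<close>. Sampling starts at \<open>k0\<close>
  rather than 0 because that formula needs a round of index at least 1.\<close>

lemma summable_gradient:
  "summable (\<lambda>n. (norm (\<Sum>i\<in>UNIV. wgrad i (y (Suc (Suc n * k0)))))\<^sup>2)"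
proof -
  have gap: "summable (\<lambda>k. (norm (X k $ i - y (Suc k)))\<^sup>2)" for i
  proof -
    have "summable (\<lambda>k. (norm (y k - y (Suc k)))\<^sup>2)"
      using summable_y_step by (simp add: norm_minus_commute)
    from summable_norm_power2_add[OF summable_consensus_gap[of i] this] show ?thesis
      by simp
  qed
  have "summable (\<lambda>k. (norm (wgrad i (y (Suc k)) - wgrad i (X k $ i)
      + \<sigma> i *\<^sub>R (X k $ i - y (Suc k))))\<^sup>2)" for i
  proof (rule summable_norm_power2_add)
    show "summable (\<lambda>k. (norm (wgrad i (y (Suc k)) - wgrad i (X k $ i)))\<^sup>2)"
      using gap[of i]
    proof (rule summable_norm_power2_dominated)
      show "norm (wgrad i (y (Suc k)) - wgrad i (X k $ i)) \<le> w i * r i * norm (X k $ i - y (Suc k))" for k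
        using wgrad_lipschitz[of i "y (Suc k)" "X k $ i"] by (simp add: norm_minus_commute)
    qed
    show "summable (\<lambda>k. (norm (\<sigma> i *\<^sub>R (X k $ i - y (Suc k))))\<^sup>2)"
      using gap[of i] by (rule summable_norm_power2_dominated[where C = "\<sigma> i"]) (use sigma_pos[of i] in simp)
  qed
  then have "summable (\<lambda>k. (norm (\<Sum>i\<in>UNIV. wgrad i (y (Suc k)) - wgrad i (X k $ i)
      + \<sigma> i *\<^sub>R (X k $ i - y (Suc k))))\<^sup>2)"
    by (rule summable_norm_power2_sum)
  moreover have "inj (\<lambda>n. Suc n * k0)"
    using k0_pos by (auto simp: inj_def)
  ultimately have "summable ((\<lambda>k. (norm (\<Sum>i\<in>UNIV. wgrad i (y (Suc k)) - wgrad i (X k $ i)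
      + \<sigma> i *\<^sub>R (X k $ i - y (Suc k))))\<^sup>2) \<circ> (\<lambda>n. Suc n * k0))"
    by (rule summable_reindex) simp
  moreover have "Suc n * k0 \<ge> 1" "k0 dvd Suc n * k0" for n
    using k0_pos by auto
  ultimately show ?thesis
    by (simp only: o_def gradient_at_communication)
qed

lemma objective_tendsto_min: "(\<lambda>k. objective w f (y k)) \<longlonglongrightarrow> objective w f xstar"
proof -
  obtain l where "lagr \<longlonglongrightarrow> l"
    by (rule lagr_convergent)
  then have "(\<lambda>k. lagr k - (lagr k - objective w f (y k))) \<longlonglongrightarrow> l - 0"
    by (intro tendsto_diff lagr_minus_objective_tendsto)
  then have lim: "(\<lambda>k. objective w f (y k)) \<longlonglongrightarrow> l"
    by simp
  have "l \<ge> objective w f xstar"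
    using lim by (rule LIMSEQ_le_const) (auto simp: objective_ge)
  \<comment> \<open>As the limit \<open>l\<close> exists already, it suffices to identify it along
    the communication rounds, where increments and gradients are both square summable.\<close>
  moreover have "l - objective w f xstar \<le> 0"
  proof (rule limit_nonpos_of_square_summable)
    let ?Y = "\<lambda>n. y (Suc (Suc n * k0))"
    show "summable (\<lambda>n. (norm (?Y (Suc n) - ?Y n))\<^sup>2)"
      using summable_block_step
      by (rule summable_Suc_iff[of "\<lambda>n. (norm (y (Suc (Suc n * k0)) - y (Suc (n * k0))))\<^sup>2", THEN iffD2])
    show "summable (\<lambda>n. (norm (\<Sum>i\<in>UNIV. wgrad i (?Y n)))\<^sup>2)"
      by (rule summable_gradient)
    show "objective w f (?Y n) - objective w f xstar
        \<le> norm (\<Sum>i\<in>UNIV. wgrad i (?Y n)) * norm (?Y n - xstar)" for n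
    proof -
      \<comment> \<open>The tangent at \<open>?Y n\<close> lies below the convex objective at
        \<open>xstar\<close>.\<close>
      have "objective w f (?Y n) - objective w f xstar
          \<le> - ((xstar - ?Y n) \<bullet> (\<Sum>i\<in>UNIV. wgrad i (?Y n)))"
        using convex_on_GDERIV_lower[OF f_convex objective_GDERIV, of "?Y n" xstar] by linarith
      also have "\<dots> = (?Y n - xstar) \<bullet> (\<Sum>i\<in>UNIV. wgrad i (?Y n))"
        by (simp only: inner_minus_left[symmetric] minus_diff_eq)
      finally show ?thesis
        using norm_cauchy_schwarz[of "?Y n - xstar" "\<Sum>i\<in>UNIV. wgrad i (?Y n)"]
        by (simp only: mult.commute)
    qed
    have "strict_mono (\<lambda>n. Suc (Suc n * k0))"
      using k0_pos by (simp add: strict_mono_Suc_iff)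
    from LIMSEQ_subseq_LIMSEQ[OF lim this]
    show "(\<lambda>n. objective w f (?Y n) - objective w f xstar) \<longlonglongrightarrow> l - objective w f xstar"
      unfolding o_def by (intro tendsto_intros)
  qed
  ultimately have "l = objective w f xstar"
    by simp
  with lim show ?thesis
    by simp
qed

section \<open>Limits of the Lagrangian and of the split objective\<close>

lemma lagr_tendsto_min: "lagr \<longlonglongrightarrow> objective w f xstar"
  using tendsto_add[OF lagr_minus_objective_tendsto objective_tendsto_min] by simp

text \<open>The iterates themselves may be unbounded, but each \<open>f i\<close> is bounded below while the
  weighted sum stays bounded, and the gradient is controlled by the excess over the infimum.\<close>

lemma gradient_bounded: "Bseq (\<lambda>k. grad (f i) (y k))"
proof -
  obtain B where B: "\<And>j x. B j \<le> f j x"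
  proof -
    have "\<forall>j. \<exists>b. \<forall>x. b \<le> f j x"
      using f_bdd by (auto simp: bdd_below_def)
    then show ?thesis
      using that by metis
  qed
  obtain M where M: "\<And>k. objective w f (y k) \<le> M"
  proof -
    have "Bseq (\<lambda>k. objective w f (y k))"
      using objective_tendsto_min by (intro convergent_imp_Bseq convergentI)
    then show ?thesis
      using that unfolding Bseq_def by (metis abs_le_D1 real_norm_def)
  qed
  have "w i * (f i (y k) - B i) \<le> M - (\<Sum>j\<in>UNIV. w j * B j)" for k
  proof -
    \<comment> \<open>All summands are nonnegative, so a bound on the total bounds each of
      them.\<close>
    have "w i * (f i (y k) - B i) \<le> (\<Sum>j\<in>UNIV. w j * (f j (y k) - B j))"
      by (rule member_le_sum) (use w_pos B in \<open>auto simp: less_imp_le\<close>)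
    also have "\<dots> = objective w f (y k) - (\<Sum>j\<in>UNIV. w j * B j)"
      by (simp add: objective_def right_diff_distrib sum_subtractf)
    finally show ?thesis
      using M[of k] by simp
  qed
  then have "f i (y k) - B i \<le> (M - (\<Sum>j\<in>UNIV. w j * B j)) / w i" for k
    using w_pos[of i] by (simp add: pos_le_divide_eq mult.commute)
  then have "2 * r i * (f i (y k) - B i) \<le> 2 * r i * ((M - (\<Sum>j\<in>UNIV. w j * B j)) / w i)" for k
    using r_pos[of i] by (intro mult_left_mono) auto
  moreover have "(norm (grad (f i) (y k)))\<^sup>2 \<le> 2 * r i * (f i (y k) - B i)" for k
    using norm_gradient_bound[of "f i" "grad (f i)", OF f_GDERIV grad_lipschitz r_pos B] .
  ultimately have "norm (grad (f i) (y k)) \<le> sqrt (2 * r i * ((M - (\<Sum>j\<in>UNIV. w j * B j)) / w i))" for k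
    by (meson order_trans real_le_rsqrt)
  then show ?thesis
    by (rule BseqI')
qed

lemma wgrad_diff_tendsto: "(\<lambda>k. wgrad i (X k $ i) - wgrad i (y k)) \<longlonglongrightarrow> 0"
proof (rule Lim_null_comparison)
  show "\<forall>\<^sub>F k in sequentially. norm (wgrad i (X k $ i) - wgrad i (y k)) \<le> w i * r i * norm (X k $ i - y k)"
    using wgrad_lipschitz by simp
  show "(\<lambda>k. w i * r i * norm (X k $ i - y k)) \<longlonglongrightarrow> 0"
    using consensus_gap_tendsto by (intro tendsto_mult_right_zero tendsto_norm_zero)
qed

text \<open>The multiplier is minus the gradient at \<open>X k $ i\<close>, which is the bounded
  gradient at \<open>y k\<close> plus a null sequence; its inner product with the vanishing gap
  tends to 0.\<close>

lemma multiplier_gap_tendsto: "(\<lambda>k. (X k $ i - y k) \<bullet> P k $ i) \<longlonglongrightarrow> 0"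
proof (rule LIMSEQ_imp_Suc)
  have grad: "Bseq (\<lambda>k. wgrad i (y k))"
  proof -
    obtain K where "\<And>k. norm (grad (f i) (y k)) \<le> K"
      using gradient_bounded[of i] by (auto simp: Bseq_def)
    then have "norm (wgrad i (y k)) \<le> w i * K" for k
      using w_pos[of i] by simp
    then show ?thesis
      by (rule BseqI')
  qed
  have "(\<lambda>k. (X k $ i - y k) \<bullet> (wgrad i (X k $ i) - wgrad i (y k)) + (X k $ i - y k) \<bullet> wgrad i (y k)) \<longlonglongrightarrow> (0::real^'n) \<bullet> 0 + 0"
  proof (intro tendsto_add tendsto_inner consensus_gap_tendsto wgrad_diff_tendsto)
    have "Zfun (\<lambda>k. (X k $ i - y k) \<bullet> wgrad i (y k)) sequentially"
      by (intro bounded_bilinear.Zfun_prod_Bfun[OF bounded_bilinear_inner] grad)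
         (use consensus_gap_tendsto[of i] in \<open>simp add: tendsto_Zfun_iff\<close>)
    then show "(\<lambda>k. (X k $ i - y k) \<bullet> wgrad i (y k)) \<longlonglongrightarrow> 0"
      by (simp add: tendsto_Zfun_iff)
  qed
  then have "(\<lambda>k. (X k $ i - y k) \<bullet> wgrad i (X k $ i)) \<longlonglongrightarrow> 0"
    by (simp only: inner_add_right[symmetric] diff_add_cancel inner_zero_left add_0_left)
  from tendsto_minus[OF LIMSEQ_Suc[OF this]]
  show "(\<lambda>k. (X (Suc k) $ i - y (Suc k)) \<bullet> P (Suc k) $ i) \<longlonglongrightarrow> 0"
    by (simp add: multiplier_eq)
qed

lemma split_objective_tendsto_min: "(\<lambda>k. split_objective w f (X k)) \<longlonglongrightarrow> objective w f xstar"
proof -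
  have "(\<lambda>k. lagr k - (\<Sum>i\<in>UNIV. (X k $ i - y k) \<bullet> P k $ i + \<sigma> i / 2 * (norm (X k $ i - y k))\<^sup>2))
      \<longlonglongrightarrow> objective w f xstar - (\<Sum>i\<in>UNIV. 0 + \<sigma> i / 2 * (norm (0::real^'n))\<^sup>2)"
    by (intro tendsto_intros lagr_tendsto_min multiplier_gap_tendsto consensus_gap_tendsto)
  then show ?thesis
    by (simp add: aug_lagrangian_def local_lagrangian_def split_objective_def sum.distrib)
qed

section \<open>Optimal triples and accumulation points\<close>

text \<open>Consensus turns the split objective into the objective, and stationarity determines the
  multipliers. Conversely, these multipliers sum to zero because the gradient vanishes at a
  minimizer.\<close>

lemma consensus_optimal_iff:
  "consensus_optimal w f (x, X', P') \<longleftrightarrow>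
     minimizer (objective w f) x \<and> X' = (\<chi> i. x) \<and> P' = (\<chi> i. - wgrad i x)"
proof
  assume opt: "consensus_optimal w f (x, X', P')"
  have "objective w f x \<le> objective w f z" for z
  proof -
    have "split_objective w f X' \<le> split_objective w f (\<chi> i. z)"
      using opt by (fastforce simp: consensus_optimal_def solves_consensus_def is_arg_min_linorder)
    then show ?thesis
      using opt by (simp add: consensus_optimal_def split_objective_def objective_def)
  qed
  then have min: "minimizer (objective w f) x"
    by (simp add: minimizer_def is_arg_min_linorder)
  have "\<forall>i. X' $ i = x" "\<forall>i. P' $ i = - wgrad i x"
    using opt by (auto simp: consensus_optimal_def eq_neg_iff_add_eq_0 add.commute)
  then have "(\<chi> i. x) = X'" "(\<chi> i. - wgrad i x) = P'"
    by (blast intro: vec_lambda_unique[THEN iffD1])+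
  with min show "minimizer (objective w f) x \<and> X' = (\<chi> i. x) \<and> P' = (\<chi> i. - wgrad i x)"
    by blast
next
  assume asm: "minimizer (objective w f) x \<and> X' = (\<chi> i. x) \<and> P' = (\<chi> i. - wgrad i x)"
  then have "(\<Sum>i\<in>UNIV. wgrad i x) = 0"
    using GDERIV_minimizer_eq_0[OF objective_GDERIV] by blast
  moreover have "solves_consensus w f x X'"
    using asm by (auto simp: solves_consensus_def minimizer_def is_arg_min_linorder
        split_objective_def objective_def)
  ultimately show "consensus_optimal w f (x, X', P')"
    using asm by (simp add: consensus_optimal_def sum_negf)
qed

text \<open>The \<open>y\<close> component alone controls the triple, by the vanishing gaps and the
  continuity of the gradients. The form with \<open>\<phi>\<close> serves accumulation points as
  well as, with the identity, the whole sequence.\<close>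

lemma iterates_tendsto:
  assumes "strict_mono \<phi>" "(y \<circ> \<phi>) \<longlonglongrightarrow> x"
  shows "(\<lambda>k. (y (\<phi> k), X (\<phi> k), P (\<phi> k))) \<longlonglongrightarrow> (x, \<chi> i. x, \<chi> i. - wgrad i x)"
proof -
  have y: "(\<lambda>k. y (\<phi> k)) \<longlonglongrightarrow> x"
    using assms(2) by (simp add: o_def)
  have Xi: "(\<lambda>k. X (\<phi> k) $ i) \<longlonglongrightarrow> x" for i
    using tendsto_add[OF LIMSEQ_subseq_LIMSEQ[OF consensus_gap_tendsto assms(1), of i] y]
    by (simp add: o_def)
  have "(\<lambda>k. P (\<phi> k) $ i) \<longlonglongrightarrow> - wgrad i x" for i
  proof (rule Lim_transform_eventually)
    show "(\<lambda>k. - wgrad i (X (\<phi> k) $ i)) \<longlonglongrightarrow> - wgrad i x"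
      by (intro tendsto_intros grad_tendsto Xi)
    show "\<forall>\<^sub>F k in sequentially. - wgrad i (X (\<phi> k) $ i) = P (\<phi> k) $ i"
      using eventually_ge_at_top[of 1]
    proof eventually_elim
      case (elim k)
      then have "\<phi> k \<ge> 1"
        using seq_suble[OF assms(1), of k] by simp
      then show ?case
        using multiplier_eq[of "\<phi> k - 1" i] by simp
    qed
  qed
  then have "(\<lambda>k. P (\<phi> k)) \<longlonglongrightarrow> (\<chi> i. - wgrad i x)"
    by (intro vec_tendstoI[where a = "\<chi> i. - wgrad i x"]) (simp only: vec_lambda_beta)
  moreover have "(\<lambda>k. X (\<phi> k)) \<longlonglongrightarrow> (\<chi> i. x)"
    by (rule vec_tendstoI) (simp only: vec_lambda_beta Xi)
  ultimately show ?thesis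
    by (intro tendsto_Pair y)
qed

text \<open>Uniqueness of limits gives the triple the form found in \<open>iterates_tendsto\<close>,
  and continuity of the objective carries the optimal value over to its first component.\<close>

lemma accumulation_point_optimal:
  assumes "accumulation_point (\<lambda>k. (y k, X k, P k)) (x, X', P')"
  shows "consensus_optimal w f (x, X', P')" and "minimizer (objective w f) x"
proof -
  obtain \<phi> where \<phi>: "strict_mono \<phi>" and lim: "(\<lambda>k. (y (\<phi> k), X (\<phi> k), P (\<phi> k))) \<longlonglongrightarrow> (x, X', P')"
    using assms by (auto simp: accumulation_point_def o_def)
  have y: "(y \<circ> \<phi>) \<longlonglongrightarrow> x"
    using tendsto_fst[OF lim] by (simp add: o_def)
  have "(x, X', P') = (x, \<chi> i. x, \<chi> i. - wgrad i x)"
    using LIMSEQ_unique[OF lim iterates_tendsto[OF \<phi> y]] .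
  moreover have "objective w f x = objective w f xstar"
    using LIMSEQ_unique[OF objective_tendsto[OF y] ] LIMSEQ_subseq_LIMSEQ[OF objective_tendsto_min \<phi>]
    by (auto simp: o_def)
  then show "minimizer (objective w f) x"
    by (simp add: minimizer_iff)
  ultimately show "consensus_optimal w f (x, X', P')"
    by (auto simp: consensus_optimal_iff)
qed

section \<open>The strongly convex case\<close>

text \<open>Strong convexity is applied at the midpoint of \<open>x\<close> and
  \<open>xstar\<close>, where the objective is at least its minimum; this leaves a quarter of the
  modulus as growth constant.\<close>

lemma strongly_convex_growth:
  assumes "strongly_convex (objective w f)"
  obtains \<mu> where "\<mu> > 0" "\<And>x. \<mu> * (norm (x - xstar))\<^sup>2 \<le> objective w f x - objective w f xstar"
proof -
  obtain \<mu> where "\<mu> > 0" and *: "\<And>x z t. t \<in> {0..1} \<Longrightarrow>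
      objective w f ((1 - t) *\<^sub>R x + t *\<^sub>R z)
        \<le> (1 - t) * objective w f x + t * objective w f z - \<mu> / 2 * t * (1 - t) * (norm (x - z))\<^sup>2"
    using assms unfolding strongly_convex_def by blast
  have "\<mu> / 4 * (norm (x - xstar))\<^sup>2 \<le> objective w f x - objective w f xstar" for x
    using *[of "1 / 2" x xstar] objective_ge[of "(1 / 2) *\<^sub>R x + (1 / 2) *\<^sub>R xstar"] by simp
  with \<open>\<mu> > 0\<close> show ?thesis
    by (intro that[of "\<mu> / 4"]) auto
qed

lemma strongly_convex_minimizer_iff:
  assumes "strongly_convex (objective w f)"
  shows "minimizer (objective w f) x \<longleftrightarrow> x = xstar"
proof -
  obtain \<mu> where \<mu>: "\<mu> > 0" "\<mu> * (norm (x - xstar))\<^sup>2 \<le> objective w f x - objective w f xstar"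
    using strongly_convex_growth[OF assms] by metis
  have "x = xstar" if "objective w f x = objective w f xstar"
  proof -
    have "(norm (x - xstar))\<^sup>2 \<le> 0"
      using \<mu> that by (simp add: mult_le_0_iff)
    then show ?thesis by simp
  qed
  then show ?thesis
    by (auto simp: minimizer_iff)
qed

lemma strongly_convex_y_tendsto:
  assumes "strongly_convex (objective w f)"
  shows "y \<longlonglongrightarrow> xstar"
proof -
  obtain \<mu> where \<mu>: "\<mu> > 0" "\<And>x. \<mu> * (norm (x - xstar))\<^sup>2 \<le> objective w f x - objective w f xstar"
    using strongly_convex_growth[OF assms] by metis
  have "(\<lambda>k. sqrt ((objective w f (y k) - objective w f xstar) / \<mu>))
      \<longlonglongrightarrow> sqrt ((objective w f xstar - objective w f xstar) / \<mu>)"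
    using \<mu>(1) by (intro tendsto_intros objective_tendsto_min) auto
  then have lim: "(\<lambda>k. sqrt ((objective w f (y k) - objective w f xstar) / \<mu>)) \<longlonglongrightarrow> 0"
    by simp
  have "(\<lambda>k. y k - xstar) \<longlonglongrightarrow> 0"
  proof (rule Lim_null_comparison[OF always_eventually lim], rule allI, rule real_le_rsqrt)
    show "(norm (y k - xstar))\<^sup>2 \<le> (objective w f (y k) - objective w f xstar) / \<mu>" for k
      using \<mu> by (simp add: pos_le_divide_eq mult.commute)
  qed
  then show ?thesis
    by (simp add: LIM_zero_iff)
qed

end

theorem corollary3p1:
  fixes w r \<sigma> :: "'m::finite \<Rightarrow> real"
    and f :: "'m \<Rightarrow> real^'n \<Rightarrow> real"
    and k0 :: nat
    and y :: "nat \<Rightarrow> real^'n"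
    and X P :: "nat \<Rightarrow> real^'n^'m"
    and xstar :: "real^'n"
  assumes w_pos: "\<And>i. w i > 0"
    and w_sum: "(\<Sum>i\<in>UNIV. w i) = 1"
    and f_bdd: "\<And>i. bdd_below (range (f i))"
    and xstar_min: "minimizer (objective w f) xstar"
    and r_pos: "\<And>i. r i > 0"
    and f_lip: "\<And>i. gradient_lipschitz (r i) (f i)"
    and sigma_pos: "\<And>i. \<sigma> i > 0"
    and sigma_gt: "\<And>i. \<sigma> i > 2 * w i * r i"
    and k0_pos: "k0 > 0"
    and gen: "ceadmm_sequence w f \<sigma> k0 y X P"
    and level_bdd: "bounded {x. objective w f x \<le> aug_lagrangian w f \<sigma> (y 0) (X 0) (P 0)}"
    and f_convex: "convex_on UNIV (objective w f)"
  shows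
    "(\<lambda>k. aug_lagrangian w f \<sigma> (y k) (X k) (P k)) \<longlonglongrightarrow> objective w f xstar \<and>
     (\<lambda>k. split_objective w f (X k)) \<longlonglongrightarrow> objective w f xstar \<and>
     (\<lambda>k. objective w f (y k)) \<longlonglongrightarrow> objective w f xstar \<and>
     (\<forall>yinf Xinf Pinf.
        accumulation_point (\<lambda>k. (y k, X k, P k)) (yinf, Xinf, Pinf) \<longrightarrow>
          consensus_optimal w f (yinf, Xinf, Pinf) \<and> minimizer (objective w f) yinf) \<and>
     (strongly_convex (objective w f) \<longrightarrow>
        (\<forall>x. minimizer (objective w f) x \<longleftrightarrow> x = xstar) \<and>
        (\<exists>Xstar Pstar.
           (\<forall>x X' P'. consensus_optimal w f (x, X', P') \<longleftrightarrow> (x, X', P') = (xstar, Xstar, Pstar)) \<and>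
           (\<lambda>k. (y k, X k, P k)) \<longlonglongrightarrow> (xstar, Xstar, Pstar)))"
proof -
  interpret ceadmm w r \<sigma> f k0 y X P xstar
    by (rule ceadmm.intro) (fact assms)+
  have "\<exists>Xstar Pstar.
      (\<forall>x X' P'. consensus_optimal w f (x, X', P') \<longleftrightarrow> (x, X', P') = (xstar, Xstar, Pstar)) \<and>
      (\<lambda>k. (y k, X k, P k)) \<longlonglongrightarrow> (xstar, Xstar, Pstar)"
    if sc: "strongly_convex (objective w f)"
  proof (intro exI conjI)
    show "\<forall>x X' P'. consensus_optimal w f (x, X', P') \<longleftrightarrow>
        (x, X', P') = (xstar, \<chi> i. xstar, \<chi> i. - wgrad i xstar)"
      using sc by (auto simp: consensus_optimal_iff strongly_convex_minimizer_iff)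
    show "(\<lambda>k. (y k, X k, P k)) \<longlonglongrightarrow> (xstar, \<chi> i. xstar, \<chi> i. - wgrad i xstar)"
      using iterates_tendsto[of id xstar] strongly_convex_y_tendsto[OF sc]
      by (simp add: strict_mono_def)
  qed
  then show ?thesis
    using lagr_tendsto_min split_objective_tendsto_min objective_tendsto_min
      accumulation_point_optimal strongly_convex_minimizer_iff
    by blast
qed

end
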